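(* Let $d, m, k, a$ be positive integers with $d > 1$ and $a > 1$. For an integer $x$ write $M_d(x) := \sum_{j=0}^{d-1} x^j$. Then the following conditions are equivalent: (1) The number $M_d(a^m)$ is divisible by the number $M_d(a^k)$. (2) $m$ is divisible by $k$ and $\gcd\left(\frac{m}{k}, d\right) = 1$.
   Context: For an integer $d>1$ and an integer $x$, the generalized Mersenne number is $M_d(x) := \sum_{j=0}^{d-1} x^j = 1 + x + \cdots + x^{d-1}$. Divisibility is divisibility in the integers. *)

theory Defs
  imports Main
begin

definition gen_mersenne :: "nat \<Rightarrow> int \<Rightarrow> int" where
  "gen_mersenne d x = (\<Sum>j<d. x ^ j)"

end

theory Submission
  imports Defs "HOL-Number_Theory.Cong"
begin

text \<open>
  Write \<open>M\<^sub>d(x)\<close> for the generalized Mersenne number, so that \<open>(x - 1) M\<^sub>d(x) = x^d - 1\<close>.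
  Everything rests on one congruence: modulo \<open>x^d - 1\<close> the power \<open>x^(n j)\<close> depends only on
  \<open>n j mod d\<close>, and as \<open>j\<close> runs through the residues modulo \<open>d\<close>, the product \<open>n j\<close> hits each
  multiple of \<open>e = gcd n d\<close> exactly \<open>e\<close> times. Hence \<open>M\<^sub>d(x^n)\<close> is congruent to
  \<open>e M\<^bsub>d/e\<^esub>(x^e)\<close> modulo \<open>x^d - 1\<close>, a multiple of \<open>M\<^sub>d(x)\<close> (lemma \<open>gen_mersenne_power_cong\<close>).
  Since \<open>M\<^sub>d(x) = M\<^sub>e(x) M\<^bsub>d/e\<^esub>(x^e)\<close>, it follows that \<open>M\<^sub>d(x)\<close> divides \<open>M\<^sub>d(x^n)\<close> iff \<open>M\<^sub>e(x)\<close>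
  divides \<open>e\<close>; for \<open>x > 1\<close> the number \<open>M\<^sub>e(x)\<close> exceeds \<open>e\<close> unless \<open>e = 1\<close>. With \<open>x = a^k\<close> this
  settles the case \<open>k dvd m\<close>.

  That \<open>k\<close> must divide \<open>m\<close> is a matter of size. If \<open>M\<^sub>d(a^k)\<close> divides \<open>M\<^sub>d(a^m)\<close>, then it divides
  both \<open>a^(k d) - 1\<close> and \<open>a^(m d) - 1\<close>, hence also \<open>a^(g d) - 1\<close> with \<open>g = gcd k m\<close>. Its leading
  term is \<open>a^(k (d - 1))\<close>, so \<open>k (d - 1) < g d\<close>; but a proper divisor \<open>g\<close> of \<open>k\<close> is at most
  \<open>k/2\<close>, which would force \<open>d < 2\<close>.
\<close>

section \<open>Generalized Mersenne numbers\<close>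

lemma gen_mersenne_0 [simp]: "gen_mersenne 0 x = 0"
  by (simp add: gen_mersenne_def)

lemma gen_mersenne_Suc: "gen_mersenne (Suc d) x = gen_mersenne d x + x ^ d"
  by (simp add: gen_mersenne_def)

lemma gen_mersenne_1 [simp]: "gen_mersenne (Suc 0) x = 1"
  by (simp add: gen_mersenne_Suc)

lemma gen_mersenne_geometric: "(x - 1) * gen_mersenne d x = x ^ d - 1"
  by (simp add: gen_mersenne_def power_diff_1_eq)

lemma gen_mersenne_dvd: "gen_mersenne d x dvd x ^ d - 1"
  by (metis dvd_triv_right gen_mersenne_geometric)

lemma gen_mersenne_add:
  "gen_mersenne (m + n) x = gen_mersenne m x + x ^ m * gen_mersenne n x"
  by (induction n) (simp_all add: gen_mersenne_Suc algebra_simps power_add)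

lemma gen_mersenne_mult:
  "gen_mersenne (m * n) x = gen_mersenne m x * gen_mersenne n (x ^ m)"
proof (induction n)
  case (Suc n)
  have "gen_mersenne (m * Suc n) x = gen_mersenne (m * n + m) x"
    by (simp add: add.commute)
  also have "\<dots> = gen_mersenne (m * n) x + x ^ (m * n) * gen_mersenne m x"
    by (rule gen_mersenne_add)
  finally show ?case
    by (simp add: Suc gen_mersenne_Suc distrib_left power_mult)
qed simp

lemma gen_mersenne_pos: "gen_mersenne d x > 0" if "d > 0" "x > 0"
  unfolding gen_mersenne_def using that by (intro sum_pos) auto

lemma gen_mersenne_cong:
  "[gen_mersenne d x = gen_mersenne d y] (mod N)" if "[x = y] (mod N)"
  unfolding gen_mersenne_def using that by (intro cong_sum cong_pow)

lemma gen_mersenne_at_1 [simp]: "gen_mersenne d 1 = int d"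
  by (simp add: gen_mersenne_def)

lemma gen_mersenne_ge: "gen_mersenne d x \<ge> int d" if "x > 0"
  using sum_mono[of "{..<d}" "\<lambda>_. 1" "\<lambda>j. x ^ j"] that
  by (simp add: gen_mersenne_def one_le_power)

lemma gen_mersenne_gt: "gen_mersenne d x > int d" if "d > 1" "x > 1"
proof -
  obtain c where c: "d = Suc c" "c > 0"
    using \<open>d > 1\<close> by (cases d) auto
  moreover have "x ^ c > 1"
    using c that by simp
  ultimately show ?thesis
    using gen_mersenne_ge[of x c] that unfolding c(1) gen_mersenne_Suc by linarith
qed

section \<open>Raising the argument to a power\<close>

lemma power_cong_mod_exponent:
  fixes x :: int
  shows "[x ^ n = x ^ (n mod d)] (mod x ^ d - 1)"
proof -
  have "[x ^ d = 1] (mod x ^ d - 1)"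
    by (simp add: cong_iff_dvd_diff)
  then have "[(x ^ d) ^ (n div d) * x ^ (n mod d) = 1 ^ (n div d) * x ^ (n mod d)] (mod x ^ d - 1)"
    by (intro cong_mult cong_pow) auto
  then show ?thesis
    by (simp flip: power_mult power_add)
qed

text \<open>Multiplication by a unit modulo \<open>d\<close> permutes the residues, hence the exponents in the sum.\<close>

lemma gen_mersenne_coprime_power_cong:
  assumes "coprime n d"
  shows "[gen_mersenne d (x ^ n) = gen_mersenne d x] (mod x ^ d - 1)"
proof -
  have inj: "inj_on (\<lambda>j. n * j mod d) {..<d}"
  proof (rule inj_onI)
    fix i j
    assume ij: "i \<in> {..<d}" "j \<in> {..<d}" and "n * i mod d = n * j mod d"
    then have "[n * i = n * j] (mod d)"
      by (simp add: cong_def)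
    then have "[i = j] (mod d)"
      using assms by (simp add: cong_mult_lcancel_nat)
    with ij show "i = j"
      by (simp add: cong_def)
  qed
  have img: "(\<lambda>j. n * j mod d) ` {..<d} = {..<d}"
    by (rule endo_inj_surj[OF _ _ inj]) auto
  have "gen_mersenne d (x ^ n) = (\<Sum>j<d. x ^ (n * j))"
    by (simp add: gen_mersenne_def flip: power_mult)
  also have "[\<dots> = (\<Sum>j<d. x ^ (n * j mod d))] (mod x ^ d - 1)"
    by (intro cong_sum power_cong_mod_exponent)
  also have "(\<Sum>j<d. x ^ (n * j mod d)) = gen_mersenne d x"
    using sum.reindex[OF inj, of "\<lambda>i. x ^ i"] img by (simp add: gen_mersenne_def)
  finally show ?thesis .
qed

text \<open>
  The general case reduces to the coprime one: writing \<open>d = e d'\<close> and \<open>n = e n'\<close>, the number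
  factors as \<open>M\<^bsub>d'\<^esub>(x^n) M\<^sub>e(x^(n d'))\<close>. In the second factor the argument is a power of \<open>x^d\<close>,
  thus 1 modulo \<open>x^d - 1\<close>, and the sum collapses to \<open>e\<close>; the first one is the coprime case for \<open>x^e\<close>.
\<close>

lemma gen_mersenne_power_cong:
  fixes d n :: nat
  assumes "d > 0"
  defines "e \<equiv> gcd n d"
  shows "[gen_mersenne d (x ^ n) = int e * gen_mersenne (d div e) (x ^ e)] (mod x ^ d - 1)"
proof -
  define d' n' where "d' = d div e" and "n' = n div e"
  have d: "d = d' * e" and n: "n = e * n'"
    by (simp_all add: d'_def n'_def e_def)
  have "coprime n' d'"
    using assms by (simp add: d'_def n'_def e_def div_gcd_coprime)
  then have 1: "[gen_mersenne d' (x ^ n) = gen_mersenne d' (x ^ e)] (mod x ^ d - 1)"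
    using gen_mersenne_coprime_power_cong[of n' d' "x ^ e"] d n
    by (simp add: mult.commute flip: power_mult)
  have "[x ^ (n * d') = x ^ (n * d' mod d)] (mod x ^ d - 1)"
    by (rule power_cong_mod_exponent)
  also have "n * d' mod d = 0"
    by (simp add: d n)
  finally have "[(x ^ n) ^ d' = 1] (mod x ^ d - 1)"
    by (simp flip: power_mult)
  then have 2: "[gen_mersenne e ((x ^ n) ^ d') = int e] (mod x ^ d - 1)"
    using gen_mersenne_cong[of "(x ^ n) ^ d'" 1] by simp
  have "gen_mersenne d (x ^ n) = gen_mersenne e ((x ^ n) ^ d') * gen_mersenne d' (x ^ n)"
    unfolding d gen_mersenne_mult by simp
  with cong_mult[OF 2 1] show ?thesis
    by (simp add: d'_def)
qed

lemma gen_mersenne_dvd_power_iff: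
  assumes "d > 0" and "x > 1"
  shows "gen_mersenne d x dvd gen_mersenne d (x ^ n) \<longleftrightarrow> gcd n d = 1"
proof -
  define e where "e = gcd n d"
  define B where "B = gen_mersenne (d div e) (x ^ e)"
  have "e > 0" and d: "d = e * (d div e)"
    using \<open>d > 0\<close> by (simp_all add: e_def)
  then have "d div e > 0"
    using \<open>d > 0\<close> by (metis gr0I mult_0_right less_irrefl)
  then have "B > 0"
    using \<open>x > 1\<close> by (simp add: B_def gen_mersenne_pos)
  have M: "gen_mersenne d x = gen_mersenne e x * B"
    unfolding B_def by (subst d) (rule gen_mersenne_mult)
  have "[gen_mersenne d (x ^ n) = int e * B] (mod gen_mersenne d x)"
    unfolding B_def e_def
    using gen_mersenne_power_cong[OF \<open>d > 0\<close>] gen_mersenne_dvd by (rule cong_dvd_modulus)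
  then have "gen_mersenne d x dvd gen_mersenne d (x ^ n) \<longleftrightarrow> gen_mersenne d x dvd int e * B"
    by (rule cong_dvd_iff)
  also have "\<dots> \<longleftrightarrow> gen_mersenne e x dvd int e"
    using \<open>B > 0\<close> by (simp add: M)
  also have "\<dots> \<longleftrightarrow> e = 1"
  proof
    assume "gen_mersenne e x dvd int e"
    then have "gen_mersenne e x \<le> int e"
      using \<open>e > 0\<close> by (intro zdvd_imp_le) auto
    with gen_mersenne_gt[of e x] \<open>x > 1\<close> \<open>e > 0\<close> show "e = 1"
      by linarith
  qed simp
  finally show ?thesis
    by (simp add: e_def)
qed

section \<open>Divisibility of the exponents\<close>

text \<open>
  The exponents \<open>n\<close> with \<open>a^n\<close> congruent to 1 modulo \<open>N\<close> are the multiples of the order of \<open>a\<close>, so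
  they are closed under \<open>gcd\<close>; the proof extracts this from a Bezout identity.
\<close>

lemma dvd_power_gcd_minus_1:
  fixes a N :: int
  assumes u: "N dvd a ^ u - 1" and v: "N dvd a ^ v - 1" and "u > 0"
  shows "N dvd a ^ gcd u v - 1"
proof -
  have cu: "[a ^ u = 1] (mod N)" and cv: "[a ^ v = 1] (mod N)"
    using u v by (simp_all add: cong_iff_dvd_diff)
  obtain s t where "u * s = v * t + gcd u v"
    using bezout_nat[of u v] \<open>u > 0\<close> by auto
  then have "(a ^ u) ^ s = (a ^ v) ^ t * a ^ gcd u v"
    by (simp flip: power_mult power_add)
  moreover have "[(a ^ u) ^ s = 1] (mod N)"
    using cong_pow[OF cu, of s] by simp
  moreover have "[(a ^ v) ^ t * a ^ gcd u v = a ^ gcd u v] (mod N)"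
    using cong_mult[OF cong_pow[OF cv, of t] cong_refl] by simp
  ultimately have "[a ^ gcd u v = 1] (mod N)"
    by (metis cong_sym cong_trans)
  then show ?thesis
    by (simp add: cong_iff_dvd_diff)
qed

lemma gen_mersenne_dvd_imp_exponent_dvd:
  fixes a :: int
  assumes "d > 1" and "k > 0" and "a > 1"
    and dvd: "gen_mersenne d (a ^ k) dvd gen_mersenne d (a ^ m)"
  shows "k dvd m"
proof -
  define g where "g = gcd k m"
  have "g > 0"
    using \<open>k > 0\<close> by (simp add: g_def)
  have "gen_mersenne d (a ^ k) dvd a ^ (k * d) - 1"
    by (simp add: gen_mersenne_dvd power_mult)
  moreover have "gen_mersenne d (a ^ k) dvd a ^ (m * d) - 1"
    using dvd gen_mersenne_dvd[of d "a ^ m"] by (simp add: power_mult dvd_trans)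
  ultimately have "gen_mersenne d (a ^ k) dvd a ^ gcd (k * d) (m * d) - 1"
    by (rule dvd_power_gcd_minus_1) (use assms in simp)
  also have "gcd (k * d) (m * d) = g * d"
    by (simp add: g_def gcd_mult_distrib_nat mult.commute)
  finally have "gen_mersenne d (a ^ k) \<le> a ^ (g * d) - 1"
    using \<open>g > 0\<close> assms by (intro zdvd_imp_le) auto
  moreover have "a ^ (k * (d - 1)) \<le> gen_mersenne d (a ^ k)"
    using gen_mersenne_Suc[of "d - 1" "a ^ k"] gen_mersenne_ge[of "a ^ k" "d - 1"] assms
    by (simp add: power_mult)
  ultimately have "a ^ (k * (d - 1)) < a ^ (g * d)"
    by linarith
  then have less: "k * (d - 1) < g * d"
    using \<open>a > 1\<close> by simp
  obtain q where q: "k = g * q"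
    unfolding g_def by (metis dvdE gcd_dvd1)
  with less have "q * (d - 1) < d"
    by (simp add: mult.assoc)
  moreover have "2 * (d - 1) \<le> q * (d - 1)" if "q \<ge> 2"
    using that by (rule mult_le_mono1)
  ultimately have "q < 2"
    using \<open>d > 1\<close> by linarith
  with q \<open>k > 0\<close> have "k = g"
    by (cases "q = 0") auto
  then show ?thesis
    by (metis g_def gcd_dvd2)
qed

theorem mainTheorem1:
  fixes d m k :: nat and a :: int
  assumes "d > 1" and "m > 0" and "k > 0" and "a > 1"
  shows "gen_mersenne d (a ^ k) dvd gen_mersenne d (a ^ m)
         \<longleftrightarrow> k dvd m \<and> gcd (m div k) d = 1"
proof (cases "k dvd m")
  case True
  then have "a ^ m = (a ^ k) ^ (m div k)"
    by (simp flip: power_mult)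
  with True show ?thesis
    using gen_mersenne_dvd_power_iff[of d "a ^ k" "m div k"] assms by simp
next
  case False
  with gen_mersenne_dvd_imp_exponent_dvd assms show ?thesis
    by blast
qed

end
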